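(* Let $P_1$ and $P_2$ be probability generating functions of distributions on $\{0,1,2,\dots\}$. Then $P_1$ and $P_2$ are of the same D-type if and only if $P_1$ is a $P_2$-compounded Bernoulli law, i.e. if and only if there is $0<c<1$ with $P_1(u)=P_2(1-c+cu)$ for all $0<u<1$.
   Context: Two probability generating functions $P_1$ and $P_2$ are said to be of the same D-type (in this order) if $P_1(1-s)=P_2(1-cs)$ for all $0<s<1$ and some $0<c<1$. The Bernoulli law with parameter $c$ has probability generating function $1-c+cs$. *)

theory Defs
  imports "HOL-Probability.Probability"
begin

definition pgf :: "nat pmf \<Rightarrow> real \<Rightarrow> real" where
  "pgf p s = (\<Sum>n. pmf p n * s ^ n)"

definition same_D_type :: "(real \<Rightarrow> real) \<Rightarrow> (real \<Rightarrow> real) \<Rightarrow> bool" where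
  "same_D_type P1 P2 \<longleftrightarrow>
     (\<exists>c. 0 < c \<and> c < 1 \<and> (\<forall>s. 0 < s \<and> s < 1 \<longrightarrow> P1 (1 - s) = P2 (1 - c * s)))"

definition bernoulli_law :: "real \<Rightarrow> nat pmf" where
  "bernoulli_law c = map_pmf of_bool (bernoulli_pmf c)"

lemma pgf_bernoulli_law:
  assumes "0 \<le> c" "c \<le> 1"
  shows "pgf (bernoulli_law c) s = 1 - c + c * s"
proof -
  have pmf0: "pmf (bernoulli_law c) 0 = 1 - c" and pmf1: "pmf (bernoulli_law c) 1 = c"
    using pmf_map_inj'[of "of_bool :: bool \<Rightarrow> nat" "bernoulli_pmf c" False]
      pmf_map_inj'[of "of_bool :: bool \<Rightarrow> nat" "bernoulli_pmf c" True] assms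
    by (auto simp: bernoulli_law_def inj_def)
  have "pmf (bernoulli_law c) n = 0" if "n \<notin> {0, 1}" for n
    using that by (auto simp: bernoulli_law_def pmf_eq_0_set_pmf of_bool_def split: if_splits)
  then have "pgf (bernoulli_law c) s = (\<Sum>n\<in>{0, 1}. pmf (bernoulli_law c) n * s ^ n)"
    unfolding pgf_def by (intro suminf_finite) auto
  then show ?thesis
    using pmf0 pmf1 by simp
qed

text \<open>
  The \<open>p\<close>-compounded \<open>q\<close> is the law of the random sum \<open>X\<^sub>1 + \<dots> + X\<^sub>N\<close>, where \<open>N\<close> has law \<open>p\<close>
  and the summands are i.i.d. with law \<open>q\<close>, independent of \<open>N\<close>.  Its probability generating
  function is \<open>pgf p \<circ> pgf q\<close> on \<open>[0, 1]\<close>.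
\<close>
definition compounded :: "nat pmf \<Rightarrow> nat pmf \<Rightarrow> nat pmf" where
  "compounded p q = bind_pmf p (\<lambda>n. map_pmf sum_list (replicate_pmf n q))"

end

theory Submission imports Defs begin

text \<open>The substitution \<open>u = 1 - s\<close> turns the D-type relation into
  \<open>P1 u = P2 (1 - c + c * u)\<close> on (0,1) (\<open>same_D_type_iff\<close>). The right-hand
  side is a composition with the Bernoulli generating function, and compounding laws composes their
  generating functions (\<open>pgf_compounded\<close>), so it belongs to the compounded law. Since
  values on (0,1) already determine a law (\<open>pmf_eqI_pgf\<close>), the identity of functions is
  an identity of laws.\<close>

lemma summable_pgf:
  assumes "\<bar>s\<bar> \<le> 1"
  shows "summable (\<lambda>n. pmf p n * s ^ n)"
proof (rule summable_comparison_test')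
  have "Infinite_Set_Sum.abs_summable_on (pmf p) UNIV"
    by (rule pmf_abs_summable)
  then show "summable (\<lambda>n. pmf p n)"
    using abs_summable_on_nat_iff'[of "pmf p"] by simp
  show "norm (pmf p n * s ^ n) \<le> pmf p n" if "n \<ge> 0" for n
    using assms by (simp add: abs_mult power_abs mult_left_le power_le_one)
qed

text \<open>Passing from series to integrals makes monotonicity, images and mixtures of laws
  available.\<close>

lemma pgf_conv_expectation:
  assumes "\<bar>s\<bar> \<le> 1"
  shows "pgf p s = measure_pmf.expectation p (\<lambda>n. s ^ n)"
proof -
  have "Infinite_Set_Sum.abs_summable_on (\<lambda>n. pmf p n * s ^ n) UNIV"
    unfolding abs_summable_on_nat_iff'
    using summable_pgf[of "\<bar>s\<bar>" p] assms by (simp add: abs_mult power_abs)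
  then show ?thesis
    by (simp add: pgf_def pmf_expectation_eq_infsetsum infsetsum_nat')
qed

text \<open>Ensures that a value \<open>pgf q s\<close> is again an admissible argument of another
  generating function.\<close>

lemma abs_pgf_le_1:
  assumes "\<bar>s\<bar> \<le> 1"
  shows "\<bar>pgf p s\<bar> \<le> 1"
proof -
  have "\<bar>measure_pmf.expectation p (\<lambda>n. s ^ n)\<bar> \<le> measure_pmf.expectation p (\<lambda>n. \<bar>s ^ n\<bar>)"
    by (rule integral_abs_bound)
  also have "\<dots> \<le> measure_pmf.expectation p (\<lambda>n. 1)"
    using assms
    by (intro integral_mono measure_pmf.integrable_const_bound[where B = 1])
       (auto simp: power_abs power_le_one)
  finally show ?thesis
    using assms by (simp add: pgf_conv_expectation)
qed

text \<open>Law of total expectation; the integrand \<open>s ^ n\<close> is bounded by 1 and all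
  measures have mass 1.\<close>

lemma pgf_bind:
  assumes "\<bar>s\<bar> \<le> 1"
  shows "pgf (bind_pmf p f) s = measure_pmf.expectation p (\<lambda>x. pgf (f x) s)"
  using assms measurable_measure_pmf[of f]
  by (simp add: pgf_conv_expectation measure_pmf_bind)
    (subst integral_bind[where B = 1 and K = "count_space UNIV" and B' = 1],
     auto simp: power_abs power_le_one measure_pmf.emeasure_space_1)

lemma pgf_sum_list_replicate:
  assumes "\<bar>s\<bar> \<le> 1"
  shows "pgf (map_pmf sum_list (replicate_pmf n q)) s = pgf q s ^ n"
proof (induction n)
  case 0
  show ?case
    using assms by (simp add: pgf_conv_expectation)
next
  case (Suc n)
  \<comment> \<open>Split off the first summand; its independence from the rest makes the
    expectation factor.\<close>
  have "map_pmf sum_list (replicate_pmf (Suc n) q) =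
        bind_pmf q (\<lambda>x. map_pmf ((+) x) (map_pmf sum_list (replicate_pmf n q)))"
    by (simp add: map_bind_pmf pmf.map_comp o_def map_pmf_def bind_assoc_pmf bind_return_pmf)
  moreover have "pgf (map_pmf ((+) x) r) s = s ^ x * pgf r s" for x r
    using assms by (simp add: pgf_conv_expectation power_add)
  ultimately show ?case
    using assms Suc by (simp add: pgf_bind) (simp add: pgf_conv_expectation)
qed

lemma pgf_compounded:
  assumes "\<bar>s\<bar> \<le> 1"
  shows "pgf (compounded p q) s = pgf p (pgf q s)"
  \<comment> \<open>Conditioning on \<open>N = n\<close> gives \<open>pgf q s ^ n\<close>; averaging
    over \<open>p\<close> is \<open>pgf p\<close> evaluated at \<open>pgf q s\<close>.\<close>
  using assms abs_pgf_le_1[OF assms]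
  by (simp add: compounded_def pgf_bind pgf_sum_list_replicate pgf_conv_expectation[of "pgf q s"])

text \<open>Once all lower coefficients vanish, dividing by \<open>x ^ m\<close> leaves a series
  that is still zero on (0,1) and tends to \<open>d m\<close> as x tends to 0.\<close>

lemma powser_eq_0_at_right:
  fixes d :: "nat \<Rightarrow> real"
  assumes sums: "\<And>x. 0 < x \<Longrightarrow> x < 1 \<Longrightarrow> (\<lambda>n. d n * x ^ n) sums 0"
  shows "d n = 0"
proof (induction n rule: less_induct)
  case (less m)
  define g where "g x = (\<Sum>n. d (n + m) * x ^ n)" for x
  have shifted: "(\<lambda>n. d (n + m) * x ^ n) sums 0" if "0 < x" "x < 1" for x
  proof -
    have "(\<lambda>n. d (n + m) * x ^ (n + m)) sums 0"
      using sums_iff_shift[of "\<lambda>n. d n * x ^ n" m 0] sums[OF that] less by simp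
    then have "(\<lambda>n. d (n + m) * x ^ (n + m) / x ^ m) sums (0 / x ^ m)"
      by (rule sums_divide)
    then show ?thesis
      using that by (simp add: power_add)
  qed
  \<comment> \<open>Convergence at the single point 1/2 gives it on a two-sided neighbourhood of 0,
    hence continuity there.\<close>
  have "summable (\<lambda>n. d (n + m) * x ^ n)" if "norm x < 1 / 2" for x
    using powser_inside[of "\<lambda>n. d (n + m)" "1 / 2" x] shifted[of "1 / 2"] that
    by (simp add: sums_iff)
  then have "(g \<longlongrightarrow> d m) (at 0)"
    using powser_limit_0[of "1 / 2" "\<lambda>n. d (n + m)" g]
    by (simp add: g_def summable_sums)
  \<comment> \<open>The series is known to vanish only for positive x, so the two limits are
    compared from the right.\<close>
  then have "(g \<longlongrightarrow> d m) (at_right 0)"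
    by (rule filterlim_mono) (auto simp: at_le)
  moreover have "eventually (\<lambda>x. g x = 0) (at_right 0)"
    using eventually_at_right_real[OF zero_less_one]
    by (rule eventually_mono) (auto simp: g_def shifted sums_unique[symmetric])
  then have "(g \<longlongrightarrow> 0) (at_right 0)"
    by (rule tendsto_eventually)
  ultimately show "d m = 0"
    by (rule tendsto_unique[rotated]) simp
qed

lemma pmf_eqI_pgf:
  assumes "\<And>u. 0 < u \<Longrightarrow> u < 1 \<Longrightarrow> pgf p u = pgf q u"
  shows "p = q"
proof (rule pmf_eqI)
  fix n
  have "pmf p n - pmf q n = 0"
  proof (rule powser_eq_0_at_right)
    fix u :: real
    assume "0 < u" "u < 1"
    then have "(\<lambda>n. pmf r n * u ^ n) sums pgf r u" for r
      unfolding pgf_def by (intro summable_sums summable_pgf) simp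
    from sums_diff[OF this[of p] this[of q]]
    show "(\<lambda>n. (pmf p n - pmf q n) * u ^ n) sums 0"
      using assms[OF \<open>0 < u\<close> \<open>u < 1\<close>] by (simp add: algebra_simps)
  qed
  then show "pmf p n = pmf q n"
    by simp
qed

lemma eq_compounded_bernoulli_iff:
  assumes "0 < c" "c < 1"
  shows "p = compounded q (bernoulli_law c) \<longleftrightarrow>
         (\<forall>u. 0 < u \<and> u < 1 \<longrightarrow> pgf p u = pgf q (1 - c + c * u))"
proof -
  have "pgf (compounded q (bernoulli_law c)) u = pgf q (1 - c + c * u)" if "0 < u" "u < 1" for u
    using that assms by (simp add: pgf_compounded pgf_bernoulli_law)
  then show ?thesis
    by (auto intro: pmf_eqI_pgf)
qed

lemma same_D_type_iff:
  "same_D_type P Q \<longleftrightarrow>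
     (\<exists>c. 0 < c \<and> c < 1 \<and> (\<forall>u. 0 < u \<and> u < 1 \<longrightarrow> P u = Q (1 - c + c * u)))"
proof -
  have "(\<forall>s. 0 < s \<and> s < 1 \<longrightarrow> P (1 - s) = Q (1 - c * s)) \<longleftrightarrow>
        (\<forall>u. 0 < u \<and> u < 1 \<longrightarrow> P u = Q (1 - c + c * u))" (is "?L \<longleftrightarrow> ?R") for c
  proof
    assume L: ?L
    show ?R
    proof (intro allI impI)
      fix u :: real
      assume "0 < u \<and> u < 1"
      with L[rule_format, of "1 - u"] show "P u = Q (1 - c + c * u)"
        by (simp add: algebra_simps)
    qed
  next
    assume R: ?R
    show ?L
    proof (intro allI impI)
      fix s :: real
      assume "0 < s \<and> s < 1"
      with R[rule_format, of "1 - s"] show "P (1 - s) = Q (1 - c * s)"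
        by (simp add: algebra_simps)
    qed
  qed
  then show ?thesis
    by (simp add: same_D_type_def)
qed

theorem theorem3p1:
  fixes p1 p2 :: "nat pmf"
  shows "(same_D_type (pgf p1) (pgf p2) \<longleftrightarrow>
            (\<exists>c. 0 < c \<and> c < 1 \<and> p1 = compounded p2 (bernoulli_law c))) \<and>
         (same_D_type (pgf p1) (pgf p2) \<longleftrightarrow>
            (\<exists>c. 0 < c \<and> c < 1 \<and> (\<forall>u. 0 < u \<and> u < 1 \<longrightarrow> pgf p1 u = pgf p2 (1 - c + c * u))))"
  using same_D_type_iff[of "pgf p1" "pgf p2"] eq_compounded_bernoulli_iff[of _ p1 p2] by metis

end
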